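(* Fix constants $k,\rho,c,\lambda,\Theta_\infty>0$ (hence $\alpha=\frac{k}{\rho c}$ and $\mathrm{Ste}=\frac{c\Theta_\infty}{\lambda}>0$). For $h>0$ let $\mathrm{Bi}=\frac{h\sqrt{\alpha}}{k}$ and let $(T_3,s_3)$, depending on $\mathrm{Bi}$, be the quadratic-profile solution of Problem (P3); let $(T_{3\infty},s_{3\infty})$ be the quadratic-profile solution of Problem (P3$_\infty$). Then the solution of (P3) converges to the solution of (P3$_\infty$) as $\mathrm{Bi}\to\infty$, that is, $$T_3(x,t)\to T_{3\infty}(x,t)\quad\text{and}\quad s_3(t)\to s_{3\infty}(t)\quad\text{when }\mathrm{Bi}\to\infty,$$ for every $t>0$ and $0<x<s_{3\infty}(t)$.
   Context: Problem (P3): find $s_3(t)$ and $T_3(x,t)$, $0\le x\le s_3(t)$, $t>0$, such that for all $t>0$: $\int_0^{s_{3}(t)}\int_0^x\frac{\partial T_3}{\partial t}(\eta,t)\,d\eta\,dx=-\frac{k}{\rho c}\left[T_{3}(0,t)+\frac{\partial T_3}{\partial x}(0,t)s_{3}(t)\right]$; $k\frac{\partial T_3}{\partial x}(0,t)=\frac{h}{\sqrt{t}}(T_{3}(0,t)+\Theta_{\infty})$; $T_{3}(s_{3}(t),t)=0$; $k\frac{\partial T_3}{\partial x}(s_{3}(t),t)=\rho\lambda\dot{s}_3(t)$; and $s_{3}(0)=0$. Problem (P3$_\infty$) is the same problem for $(T_{3\infty},s_{3\infty})$ with the second condition (the convective one) replaced by $T_{3\infty}(0,t)=-\Theta_\infty$,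 $t>0$. A quadratic-profile solution of either problem is one of the form $T(x,t)=-A\Theta_\infty\left(1-\frac{x}{s(t)}\right)-B\Theta_\infty\left(1-\frac{x}{s(t)}\right)^2$ with constants $A>0$, $B>0$. Each problem has exactly one such solution, and explicitly: (P3): $s_3(t)=2\xi_3\sqrt{\alpha t}$, $A=A_3=\frac{2\xi_{3}(3-\xi_3^{2})}{\frac{1}{\mathrm{Bi}}\xi_{3}^{2}+6\xi_{3}+\frac{3}{\mathrm{Bi}}}$, $B=B_3=\frac{2\xi_{3}^{3}}{\frac{1}{\mathrm{Bi}}\xi_{3}^{2}+6\xi_{3}+\frac{3}{\mathrm{Bi}}}$, where $\xi_3$ is the unique solution in $(0,\sqrt3)$ of $\frac{1}{\mathrm{Bi}}z^{3}+(6+\mathrm{Ste})z^{2}+\frac{3}{\mathrm{Bi}}z-3\mathrm{Ste}=0$. (P3$_\infty$): $s_{3\infty}(t)=2\xi_{3\infty}\sqrt{\alpha t}$, $\xi_{3\infty}=\sqrt{\frac{3\mathrm{Ste}}{6+\mathrm{Ste}}}$, $A=A_{3\infty}=\frac{6}{6+\mathrm{Ste}}$, $B=B_{3\infty}=\frac{\mathrm{Ste}}{6+\mathrm{Ste}}$. *)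

theory Defs
  imports "HOL-Analysis.Analysis"
begin

definition diffusivity :: "real \<Rightarrow> real \<Rightarrow> real \<Rightarrow> real" where
  "diffusivity k \<rho> c = k / (\<rho> * c)"

definition Biot :: "real \<Rightarrow> real \<Rightarrow> real \<Rightarrow> real \<Rightarrow> real" where
  "Biot k \<rho> c h = h * sqrt (diffusivity k \<rho> c) / k"

text \<open>
  A temperature is a total function \<open>T x t\<close> which is only meaningful on the region
  \<open>0 \<le> x \<le> s t\<close>, \<open>t > 0\<close>.  The space derivative is therefore taken
  relative to the interval \<open>{0..s t}\<close>, which makes it one-sided at \<open>x = 0\<close>
  and at the free boundary \<open>x = s t\<close>.  The time derivative can be the ordinary \<open>deriv\<close>: it is
  used under the integral only, and since \<open>s\<close> is continuous the region contains a
  neighbourhood of \<open>t\<close> for each \<open>0 < x < s t\<close>.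
\<close>

definition space_deriv ::
  "(real \<Rightarrow> real \<Rightarrow> real) \<Rightarrow> (real \<Rightarrow> real) \<Rightarrow> real \<Rightarrow> real \<Rightarrow> real" where
  "space_deriv T s x t = vector_derivative (\<lambda>y. T y t) (at x within {0..s t})"

definition time_deriv :: "(real \<Rightarrow> real \<Rightarrow> real) \<Rightarrow> real \<Rightarrow> real \<Rightarrow> real" where
  "time_deriv T x t = deriv (\<lambda>\<tau>. T x \<tau>) t"

text \<open>
  The regularity implicit in writing down the problem: the domain is nondegenerate for
  \<open>t > 0\<close>, and the derivatives and integrals that occur in it exist.  Continuity of \<open>s\<close> up to
  \<open>t = 0\<close> is what makes \<open>s 0 = 0\<close> an initial condition (without it the value \<open>s 0\<close> would be
  unrelated to the other values of \<open>s\<close>).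
\<close>

definition regular_pair :: "(real \<Rightarrow> real \<Rightarrow> real) \<Rightarrow> (real \<Rightarrow> real) \<Rightarrow> bool" where
  "regular_pair T s \<longleftrightarrow>
     continuous_on {0..} s \<and>
     (\<forall>t>0. 0 < s t \<and> s differentiable (at t) \<and>
       (\<forall>x\<in>{0..s t}. (\<lambda>y. T y t) differentiable (at x within {0..s t})) \<and>
       (\<forall>x. 0 < x \<and> x < s t \<longrightarrow> (\<lambda>\<tau>. T x \<tau>) differentiable (at t)) \<and>
       (\<lambda>x. time_deriv T x t) integrable_on {0..s t})"

text \<open>
  The conditions common to the two problems, i.e. all of them except the one imposed at the
  fixed face \<open>x = 0\<close>;  \<open>l\<close> is the latent heat.
\<close>

definition stefan_conditions ::
  "real \<Rightarrow> real \<Rightarrow> real \<Rightarrow> real \<Rightarrow> (real \<Rightarrow> real \<Rightarrow> real) \<Rightarrow> (real \<Rightarrow> real) \<Rightarrow> bool" where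
  "stefan_conditions k \<rho> c l T s \<longleftrightarrow>
     regular_pair T s \<and>
     (\<forall>t>0.
        integral {0..s t} (\<lambda>x. integral {0..x} (\<lambda>\<eta>. time_deriv T \<eta> t))
          = - (k / (\<rho> * c)) * (T 0 t + space_deriv T s 0 t * s t) \<and>
        T (s t) t = 0 \<and>
        k * space_deriv T s (s t) t = \<rho> * l * deriv s t) \<and>
     s 0 = 0"

definition problem_P3 ::
  "real \<Rightarrow> real \<Rightarrow> real \<Rightarrow> real \<Rightarrow> real \<Rightarrow> real \<Rightarrow> (real \<Rightarrow> real \<Rightarrow> real) \<Rightarrow> (real \<Rightarrow> real) \<Rightarrow> bool"
where
  "problem_P3 k \<rho> c l \<Theta> h T s \<longleftrightarrow>
     stefan_conditions k \<rho> c l T s \<and>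
     (\<forall>t>0. k * space_deriv T s 0 t = h / sqrt t * (T 0 t + \<Theta>))"

definition problem_P3_inf ::
  "real \<Rightarrow> real \<Rightarrow> real \<Rightarrow> real \<Rightarrow> real \<Rightarrow> (real \<Rightarrow> real \<Rightarrow> real) \<Rightarrow> (real \<Rightarrow> real) \<Rightarrow> bool" where
  "problem_P3_inf k \<rho> c l \<Theta> T s \<longleftrightarrow>
     stefan_conditions k \<rho> c l T s \<and> (\<forall>t>0. T 0 t = - \<Theta>)"

definition quadratic_profile ::
  "real \<Rightarrow> (real \<Rightarrow> real \<Rightarrow> real) \<Rightarrow> (real \<Rightarrow> real) \<Rightarrow> bool" where
  "quadratic_profile \<Theta> T s \<longleftrightarrow>
     (\<exists>A>0. \<exists>B>0. \<forall>t>0. \<forall>x\<in>{0..s t}.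
        T x t = - A * \<Theta> * (1 - x / s t) - B * \<Theta> * (1 - x / s t)\<^sup>2)"

end

theory Submission
  imports Defs
begin

text \<open>
  Put \<open>Ste = c \<Theta> / l\<close>.  For a quadratic profile the Stefan condition makes \<open>s s'\<close> constant, so
  \<open>s\<close> is a multiple of \<open>sqrt (A t)\<close>, and the integral condition becomes \<open>Ste A (A + B) = 6 B\<close>.
  Hence everything is a continuous function of \<open>w = A + B\<close>, namely \<open>A = 6 w / (6 + Ste w)\<close>.  In
  (P3\<open>\<^sub>\<infinity>\<close>) one has \<open>w = 1\<close>, while the convective condition of (P3) gives
  \<open>0 < 1 - w \<le> C / Bi\<close>, so no analysis of the cubic for \<open>\<xi>\<^sub>3\<close> is needed.
\<close>

text \<open>The condition at \<open>x = 0\<close> is left out, so that every fact holds for (P3) and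
  (P3\<infinity>) alike. \<open>A\<close> and \<open>B\<close> are parameters because they do not
  vary with time.\<close>

locale quadratic_stefan_solution =
  fixes k \<rho> c l \<Theta> A B :: real and T :: "real \<Rightarrow> real \<Rightarrow> real" and s :: "real \<Rightarrow> real"
  assumes const_pos: "k > 0" "\<rho> > 0" "c > 0" "l > 0" "\<Theta> > 0" "A > 0" "B > 0"
    and stefan: "stefan_conditions k \<rho> c l T s"
    and profile: "\<And>t x. t > 0 \<Longrightarrow> 0 \<le> x \<Longrightarrow> x \<le> s t \<Longrightarrow>
          T x t = - A * \<Theta> * (1 - x / s t) - B * \<Theta> * (1 - x / s t)\<^sup>2"
begin

section \<open>Derivatives of the profile and the double integral\<close>

lemma s_pos: "t > 0 \<Longrightarrow> s t > 0"
  using stefan by (auto simp: stefan_conditions_def regular_pair_def)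

lemma s_has_deriv: "t > 0 \<Longrightarrow> (s has_real_derivative deriv s t) (at t)"
  using stefan by (auto simp: stefan_conditions_def regular_pair_def DERIV_deriv_iff_real_differentiable)

text \<open>The profile formula is available only on \<open>{0..s t}\<close> and is differentiated
  within that interval. As \<open>s t > 0\<close>, the derivative there is unique, also at the two
  ends.\<close>

lemma space_deriv_eq:
  assumes t: "t > 0" and x: "0 \<le> x" "x \<le> s t"
  shows "space_deriv T s x t = \<Theta> / s t * (A + 2 * B * (1 - x / s t))"
proof -
  have st: "s t > 0" using s_pos[OF t] .
  have "((\<lambda>y. - A * \<Theta> * (1 - y / s t) - B * \<Theta> * (1 - y / s t)\<^sup>2)
          has_real_derivative \<Theta> / s t * (A + 2 * B * (1 - x / s t))) (at x within {0..s t})"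
    by (rule derivative_eq_intros refl | use st in \<open>simp add: field_simps\<close>)+
  then have "((\<lambda>y. T y t) has_vector_derivative \<Theta> / s t * (A + 2 * B * (1 - x / s t)))
          (at x within {0..s t})"
    unfolding has_real_derivative_iff_has_vector_derivative
    by (rule has_vector_derivative_transform[rotated 2]) (use x t profile in auto)
  then show ?thesis
    unfolding space_deriv_def
    using vector_derivative_within_closed_interval[of 0 "s t" x] x st by auto
qed

lemma time_deriv_eq:
  assumes t: "t > 0" and x: "0 < x" "x < s t"
  shows "time_deriv T x t = - \<Theta> * deriv s t / (s t)\<^sup>2 * ((A + 2 * B) * x - 2 * B / s t * x\<^sup>2)"
proof -
  have st: "s t > 0" using s_pos[OF t] .
  \<comment> \<open>The formula for \<open>T x \<tau>\<close> needs \<open>x \<le> s \<tau>\<close>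
    and \<open>\<tau> > 0\<close>. Continuity of \<open>s\<close> secures the first for all
    \<open>\<tau>\<close> near \<open>t\<close>, because \<open>x < s t\<close> is strict.\<close>
  have "isCont s t" using DERIV_isCont s_has_deriv[OF t] by blast
  then have "\<forall>\<^sub>F \<tau> in nhds t. x < s \<tau>"
    using x(2) by (intro order_tendstoD) (auto simp: isCont_def tendsto_at_iff_tendsto_nhds)
  moreover have "\<forall>\<^sub>F \<tau> in nhds t. 0 < \<tau>"
    using t by (intro order_tendstoD) (auto simp: filterlim_ident)
  ultimately have near: "\<forall>\<^sub>F \<tau> in nhds t.
      - A * \<Theta> * (1 - x / s \<tau>) - B * \<Theta> * (1 - x / s \<tau>)\<^sup>2 = T x \<tau>"
    by eventually_elim (use x profile in auto)
  have "((\<lambda>\<tau>. - A * \<Theta> * (1 - x / s \<tau>) - B * \<Theta> * (1 - x / s \<tau>)\<^sup>2) has_real_derivative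
      - \<Theta> * deriv s t / (s t)\<^sup>2 * ((A + 2 * B) * x - 2 * B / s t * x\<^sup>2)) (at t)"
    using st by (auto intro!: derivative_eq_intros s_has_deriv t)
      (simp add: field_simps power2_eq_square)
  then show ?thesis
    unfolding time_deriv_def using near DERIV_cong_ev[OF refl near refl] DERIV_imp_deriv by blast
qed

lemma double_integral_time_deriv:
  assumes t: "t > 0"
  shows "integral {0..s t} (\<lambda>x. integral {0..x} (\<lambda>\<eta>. time_deriv T \<eta> t))
    = - \<Theta> * s t * deriv s t * (A + B) / 6"
proof -
  have st: "s t > 0" using s_pos[OF t] .
  \<comment> \<open>\<open>F\<close> and \<open>G\<close> are the first and second antiderivatives
    in \<open>x\<close> of the formula for \<open>time_deriv T x t\<close>, both vanishing at
    \<open>0\<close>.\<close>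
  define D where "D = - \<Theta> * deriv s t / (s t)\<^sup>2"
  define F where "F = (\<lambda>x. D * ((A + 2 * B) * x^2 / 2 - 2 * B / s t * x^3 / 3))"
  define G where "G = (\<lambda>x. D * ((A + 2 * B) * x^3 / 6 - 2 * B / s t * x^4 / 12))"
  have inner: "integral {0..x} (\<lambda>\<eta>. time_deriv T \<eta> t) = F x" if x: "0 \<le> x" "x \<le> s t" for x
  proof -
    \<comment> \<open>\<open>time_deriv\<close> is known only for \<open>0 < y < s t\<close>, hence
      the fundamental theorem with the derivative required in the interior only.\<close>
    have "((\<lambda>\<eta>. time_deriv T \<eta> t) has_integral F x - F 0) {0..x}"
    proof (rule fundamental_theorem_of_calculus_interior[OF x(1)])
      show "continuous_on {0..x} F"
        unfolding F_def by (intro continuous_intros) auto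
      fix y assume y: "y \<in> {0<..<x}"
      have "(F has_real_derivative D * ((A + 2 * B) * y - 2 * B / s t * y\<^sup>2)) (at y)"
        unfolding F_def by (rule derivative_eq_intros refl | simp)+
      then show "(F has_vector_derivative time_deriv T y t) (at y)"
        using y x(2) time_deriv_eq[OF t, of y]
        by (simp add: D_def has_real_derivative_iff_has_vector_derivative)
    qed
    then show ?thesis by (simp add: F_def integral_unique)
  qed
  have "(F has_integral G (s t) - G 0) {0..s t}"
  proof (rule fundamental_theorem_of_calculus)
    fix y
    have "(G has_real_derivative F y) (at y within {0..s t})"
      unfolding F_def G_def
      by (rule derivative_eq_intros refl | simp add: field_simps)+
    then show "(G has_vector_derivative F y) (at y within {0..s t})"
      by (simp add: has_real_derivative_iff_has_vector_derivative)
  qed (use st in simp)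
  then have "integral {0..s t} F = G (s t)"
    by (simp add: G_def integral_unique)
  moreover have "integral {0..s t} (\<lambda>x. integral {0..x} (\<lambda>\<eta>. time_deriv T \<eta> t)) = integral {0..s t} F"
    by (rule integral_cong) (simp add: inner)
  moreover have "G (s t) = - \<Theta> * s t * deriv s t * (A + B) / 6"
    using st by (simp add: G_def D_def field_simps power2_eq_square power3_eq_cube power4_eq_xxxx)
  ultimately show ?thesis by simp
qed

section \<open>Coefficients and free boundary\<close>

lemma boundary_velocity:
  assumes t: "t > 0"
  shows "s t * deriv s t = k * \<Theta> / (\<rho> * l) * A"
proof -
  have st: "s t > 0" using s_pos[OF t] .
  \<comment> \<open>At \<open>x = s t\<close> the quadratic term has slope zero, so only
    \<open>A\<close> enters the Stefan condition.\<close>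
  have "k * space_deriv T s (s t) t = \<rho> * l * deriv s t"
    using stefan t by (simp add: stefan_conditions_def)
  then show ?thesis
    using space_deriv_eq[OF t, of "s t"] st const_pos by (simp add: field_simps)
qed

text \<open>This is the integral condition with \<open>s t * deriv s t\<close> replaced by its
  constant value. Time then drops out, so a single instant suffices.\<close>

lemma coefficient_relation: "c * \<Theta> / l * (A * (A + B)) = 6 * B"
proof -
  define t :: real where "t = 1"
  have t: "t > 0" by (simp add: t_def)
  have st: "s t > 0" using s_pos[OF t] .
  have "integral {0..s t} (\<lambda>x. integral {0..x} (\<lambda>\<eta>. time_deriv T \<eta> t))
          = - (k / (\<rho> * c)) * (T 0 t + space_deriv T s 0 t * s t)"
    using stefan t by (simp add: stefan_conditions_def)
  \<comment> \<open>The temperature contributes \<open>- \<Theta> * (A + B)\<close> and the slope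
    term \<open>\<Theta> * (A + 2 * B)\<close>; the terms in \<open>A\<close> cancel.\<close>
  moreover have "T 0 t + space_deriv T s 0 t * s t = \<Theta> * B"
    using profile[OF t, of 0] space_deriv_eq[OF t, of 0] st by (simp add: field_simps)
  ultimately have "\<Theta> * (s t * deriv s t) * (A + B) / 6 = k / (\<rho> * c) * (\<Theta> * B)"
    using double_integral_time_deriv[OF t] by (simp add: mult.assoc)
  then have "(\<Theta> * \<rho> * k) * (c * \<Theta> * (A * (A + B))) = (\<Theta> * \<rho> * k) * (6 * B * l)"
    unfolding boundary_velocity[OF t] using const_pos by (simp add: field_simps)
  then have "c * \<Theta> * (A * (A + B)) = 6 * B * l"
    using const_pos by simp
  then show ?thesis
    using const_pos by (simp add: field_simps)
qed

text \<open>The square of \<open>s\<close> has the constant derivative \<open>2 * K * A\<close> for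
  positive times and vanishes at \<open>0\<close>. Continuity of \<open>s\<close> up to
  \<open>0\<close> links the two facts.\<close>

lemma boundary_eq:
  assumes t: "t > 0"
  shows "s t = sqrt (2 * (k * \<Theta> / (\<rho> * l)) * A) * sqrt t"
proof -
  define K where "K = k * \<Theta> / (\<rho> * l)"
  define g where "g = (\<lambda>t. (s t)\<^sup>2 - 2 * K * A * t)"
  have "g t = g 0"
  proof (rule DERIV_isconst_end[OF t])
    have "continuous_on {0..t} s"
      using stefan continuous_on_subset[of "{0..}" s "{0..t}"]
      by (auto simp: stefan_conditions_def regular_pair_def)
    then show "continuous_on {0..t} g"
      unfolding g_def by (intro continuous_intros)
    fix x :: real assume x: "0 < x" "x < t"
    have "(g has_real_derivative 2 * (s x * deriv s x) - 2 * K * A) (at x)"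
      unfolding g_def by (rule derivative_eq_intros s_has_deriv x refl | simp)+
    then show "(g has_real_derivative 0) (at x)"
      using boundary_velocity[OF x(1)] by (simp add: K_def)
  qed
  moreover have "s 0 = 0"
    using stefan by (simp add: stefan_conditions_def)
  ultimately have "(s t)\<^sup>2 = 2 * K * A * t"
    by (simp add: g_def)
  then have "s t = sqrt (2 * K * A * t)"
    using s_pos[OF t] by (metis less_eq_real_def real_sqrt_unique)
  then show ?thesis
    unfolding K_def by (simp only: real_sqrt_mult)
qed

text \<open>Writing \<open>w\<close> for \<open>A + B\<close>, the relation
  \<open>Ste * A * w = 6 * (w - A)\<close> is linear in \<open>A\<close>.\<close>

lemma A_eq: "A = 6 * (A + B) / (6 + c * \<Theta> / l * (A + B))"
proof -
  have "6 + c * \<Theta> / l * (A + B) > 0"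
    using const_pos by (simp add: add_pos_pos)
  then show ?thesis
    using coefficient_relation by (simp add: field_simps)
qed

text \<open>
  The bound on \<open>1 - (A + B)\<close> uses \<open>A + 2 B \<le> (1 + Ste / 3) A\<close> and \<open>A \<le> sqrt A\<close>, which cancels the
  factor \<open>sqrt A\<close> coming from \<open>s\<close>.
\<close>

lemma convective_bound:
  assumes h: "h > 0"
    and conv: "\<forall>t>0. k * space_deriv T s 0 t = h / sqrt t * (T 0 t + \<Theta>)"
  shows "A + B < 1"
    and "1 - (A + B) \<le> k * (1 + c * \<Theta> / l / 3) / (h * sqrt (2 * (k * \<Theta> / (\<rho> * l))))"
proof -
  define K where "K = 2 * (k * \<Theta> / (\<rho> * l))"
  define S where "S = c * \<Theta> / l"
  have K: "K > 0" and S: "S > 0" using const_pos by (simp_all add: K_def S_def)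
  have s1: "s 1 = sqrt K * sqrt A"
    using boundary_eq[of 1] unfolding K_def by (simp only: real_sqrt_mult real_sqrt_one mult_1_right)
  have "k * (\<Theta> / s 1 * (A + 2 * B)) = h * (\<Theta> - A * \<Theta> - B * \<Theta>)"
    using conv[rule_format, of 1] space_deriv_eq[of 1 0] profile[of 1 0] s_pos[of 1] by simp
  then have "\<Theta> * (k * (A + 2 * B)) = \<Theta> * (h * s 1 * (1 - (A + B)))"
    using s_pos[of 1] by (simp add: field_simps)
  then have eq: "k * (A + 2 * B) = h * sqrt K * sqrt A * (1 - (A + B))"
    using const_pos by (simp add: s1 mult.assoc)
  \<comment> \<open>The left side of \<open>eq\<close> and the factor before
    \<open>1 - (A + B)\<close> are positive, hence so is \<open>1 - (A + B)\<close>.\<close>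
  have "0 < h * sqrt K * sqrt A" "0 < k * (A + 2 * B)" using const_pos h K by simp_all
  then show lt: "A + B < 1"
    using zero_less_mult_pos[of "h * sqrt K * sqrt A" "1 - (A + B)"] unfolding eq by simp
  have "A * A \<le> A"
    using lt const_pos by (intro mult_left_le) auto
  then have A: "A \<le> sqrt A"
    by (intro real_le_rsqrt) (simp add: power2_eq_square)
  \<comment> \<open>By \<open>coefficient_relation\<close> the left side is \<open>6 * B\<close>, so
    \<open>A + B < 1\<close> yields \<open>2 * B \<le> S / 3 * A\<close>.\<close>
  have "S * (A * (A + B)) \<le> S * (A * 1)"
    using S lt const_pos by (intro mult_left_mono) auto
  then have "A + 2 * B \<le> A * (1 + S / 3)"
    using coefficient_relation by (simp add: S_def algebra_simps)
  also have "A * (1 + S / 3) \<le> sqrt A * (1 + S / 3)"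
    using A S by (intro mult_right_mono) auto
  finally have "k * (A + 2 * B) \<le> k * (sqrt A * (1 + S / 3))"
    using const_pos by (intro mult_left_mono) auto
  then have "sqrt A * (h * sqrt K * (1 - (A + B))) \<le> sqrt A * (k * (1 + S / 3))"
    unfolding eq by (simp add: mult_ac)
  then have "h * sqrt K * (1 - (A + B)) \<le> k * (1 + S / 3)"
    using const_pos by simp
  then show "1 - (A + B) \<le> k * (1 + c * \<Theta> / l / 3) / (h * sqrt (2 * (k * \<Theta> / (\<rho> * l))))"
    using h K unfolding K_def[symmetric] S_def[symmetric] by (simp add: pos_le_divide_eq mult_ac)
qed

lemma A_plus_B_of_Dirichlet:
  assumes "\<forall>t>0. T 0 t = - \<Theta>"
  shows "A + B = 1"
proof -
  have "\<Theta> * (A + B) = \<Theta> * 1"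
    using assms profile[of 1 0] s_pos[of 1] by (simp add: algebra_simps)
  then show ?thesis using const_pos by simp
qed

end

section \<open>Passage to the limit\<close>

lemma quadratic_profileE:
  assumes "k > 0" "\<rho> > 0" "c > 0" "l > 0" "\<Theta> > 0"
    and "stefan_conditions k \<rho> c l T s" and "quadratic_profile \<Theta> T s"
  obtains A B where "quadratic_stefan_solution k \<rho> c l \<Theta> A B T s"
proof -
  obtain A B where "A > 0" "B > 0" "\<forall>t>0. \<forall>x\<in>{0..s t}.
      T x t = - A * \<Theta> * (1 - x / s t) - B * \<Theta> * (1 - x / s t)\<^sup>2"
    using assms(7) unfolding quadratic_profile_def by blast
  with assms(1-6) have "quadratic_stefan_solution k \<rho> c l \<Theta> A B T s"
    unfolding quadratic_stefan_solution_def by simp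
  then show thesis by (rule that)
qed

text \<open>Convergence passes from \<open>A + B\<close> to \<open>A\<close> by \<open>A_eq\<close>,
  then to \<open>B\<close>, to \<open>s\<close> by \<open>boundary_eq\<close>, and to
  \<open>T\<close> by the profile. Only \<open>h b\<close> tending to infinity matters, so the index
  \<open>b\<close> may be the Biot number.\<close>

lemma problem_P3_tendsto:
  fixes k \<rho> c l \<Theta> A' B' :: real and A B h :: "real \<Rightarrow> real"
    and T :: "real \<Rightarrow> real \<Rightarrow> real \<Rightarrow> real" and s :: "real \<Rightarrow> real \<Rightarrow> real"
  assumes sol: "\<forall>\<^sub>F b in F. quadratic_stefan_solution k \<rho> c l \<Theta> (A b) (B b) (T b) (s b)"
    and P3: "\<forall>\<^sub>F b in F. problem_P3 k \<rho> c l \<Theta> (h b) (T b) (s b)"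
    and h: "filterlim h at_top F"
    and sol': "quadratic_stefan_solution k \<rho> c l \<Theta> A' B' T' s'"
    and P3': "problem_P3_inf k \<rho> c l \<Theta> T' s'"
    and t: "t > 0"
  shows "((\<lambda>b. s b t) \<longlongrightarrow> s' t) F"
    and "0 < x \<Longrightarrow> x < s' t \<Longrightarrow> ((\<lambda>b. T b x t) \<longlongrightarrow> T' x t) F"
proof -
  interpret lim: quadratic_stefan_solution k \<rho> c l \<Theta> A' B' T' s' by (rule sol')
  have w': "A' + B' = 1"
    using P3' by (intro lim.A_plus_B_of_Dirichlet) (simp add: problem_P3_inf_def)
  \<comment> \<open>This is the constant of \<open>convective_bound\<close> with the factor
    \<open>1 / h\<close> split off; it does not depend on \<open>b\<close>.\<close>
  define C where "C = k * (1 + c * \<Theta> / l / 3) / sqrt (2 * (k * \<Theta> / (\<rho> * l)))"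
  have ev: "\<forall>\<^sub>F b in F. A b + B b \<le> 1 \<and> 1 - C / h b \<le> A b + B b"
    using sol P3 filterlim_at_top_dense[THEN iffD1, OF h, rule_format, of 0]
  proof eventually_elim
    case (elim b)
    interpret quadratic_stefan_solution k \<rho> c l \<Theta> "A b" "B b" "T b" "s b" by (rule elim)
    have "\<forall>t>0. k * space_deriv (T b) (s b) 0 t = h b / sqrt t * (T b 0 t + \<Theta>)"
      using elim by (simp add: problem_P3_def)
    from convective_bound[OF elim(3) this] show ?case
      by (simp add: C_def field_simps)
  qed
  have "((\<lambda>b. 1 - C / h b) \<longlongrightarrow> 1 - 0) F"
    by (intro tendsto_diff tendsto_const tendsto_divide_0[OF tendsto_const]
        filterlim_at_top_imp_at_infinity h)
  then have w: "((\<lambda>b. A b + B b) \<longlongrightarrow> 1) F"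
    using ev by (intro tendsto_sandwich[of "\<lambda>b. 1 - C / h b" "\<lambda>b. A b + B b" F "\<lambda>b. 1" 1])
      (simp_all add: eventually_conj_iff)
  have "((\<lambda>b. 6 * (A b + B b) / (6 + c * \<Theta> / l * (A b + B b))) \<longlongrightarrow> 6 * 1 / (6 + c * \<Theta> / l * 1)) F"
    using lim.const_pos
    by (intro tendsto_intros w less_imp_neq[symmetric] add_pos_pos mult_pos_pos divide_pos_pos) auto
  moreover have "6 * 1 / (6 + c * \<Theta> / l * 1) = A'"
    using lim.A_eq unfolding w' by simp
  moreover have "\<forall>\<^sub>F b in F. 6 * (A b + B b) / (6 + c * \<Theta> / l * (A b + B b)) = A b"
    using sol by eventually_elim (metis quadratic_stefan_solution.A_eq)
  ultimately have A: "(A \<longlongrightarrow> A') F"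
    by (simp add: tendsto_cong)
  have "((\<lambda>b. (A b + B b) - A b) \<longlongrightarrow> (A' + B') - A') F"
    unfolding w' by (intro tendsto_diff w A)
  then have B: "(B \<longlongrightarrow> B') F"
    by simp
  have "((\<lambda>b. sqrt (2 * (k * \<Theta> / (\<rho> * l)) * A b) * sqrt t) \<longlongrightarrow> s' t) F"
    unfolding lim.boundary_eq[OF t] by (intro tendsto_intros A)
  moreover have "\<forall>\<^sub>F b in F. sqrt (2 * (k * \<Theta> / (\<rho> * l)) * A b) * sqrt t = s b t"
    using sol by eventually_elim (metis quadratic_stefan_solution.boundary_eq t)
  ultimately show s: "((\<lambda>b. s b t) \<longlongrightarrow> s' t) F"
    by (rule Lim_transform_eventually)
  show "((\<lambda>b. T b x t) \<longlongrightarrow> T' x t) F" if x: "0 < x" "x < s' t"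
  proof -
    have "((\<lambda>b. - A b * \<Theta> * (1 - x / s b t) - B b * \<Theta> * (1 - x / s b t)\<^sup>2) \<longlongrightarrow> T' x t) F"
      using x lim.profile[OF t, of x] by (auto intro!: tendsto_intros A B s)
    \<comment> \<open>The profile of \<open>T b\<close> is valid at \<open>x\<close> only if
      \<open>x \<le> s b t\<close>. This holds eventually, as \<open>s b t\<close> tends to
      \<open>s' t > x\<close>.\<close>
    moreover have "\<forall>\<^sub>F b in F.
        - A b * \<Theta> * (1 - x / s b t) - B b * \<Theta> * (1 - x / s b t)\<^sup>2 = T b x t"
      using sol order_tendstoD(1)[OF s x(2)]
    proof eventually_elim
      case (elim b)
      show ?case
        using quadratic_stefan_solution.profile[OF elim(1) t, of x] x elim(2) by simp
    qed
    ultimately show ?thesis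
      by (rule Lim_transform_eventually)
  qed
qed

theorem theorem4p6:
  fixes k \<rho> c l \<Theta> :: real
    and T3 :: "real \<Rightarrow> real \<Rightarrow> real \<Rightarrow> real" and s3 :: "real \<Rightarrow> real \<Rightarrow> real"
    and T3_inf :: "real \<Rightarrow> real \<Rightarrow> real" and s3_inf :: "real \<Rightarrow> real"
  assumes "k > 0" "\<rho> > 0" "c > 0" "l > 0" "\<Theta> > 0"
    and "\<And>h. h > 0 \<Longrightarrow> problem_P3 k \<rho> c l \<Theta> h (T3 (Biot k \<rho> c h)) (s3 (Biot k \<rho> c h))"
    and "\<And>h. h > 0 \<Longrightarrow> quadratic_profile \<Theta> (T3 (Biot k \<rho> c h)) (s3 (Biot k \<rho> c h))"
    and "problem_P3_inf k \<rho> c l \<Theta> T3_inf s3_inf"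
    and "quadratic_profile \<Theta> T3_inf s3_inf"
  shows "\<forall>t>0.
      (\<forall>x. 0 < x \<and> x < s3_inf t \<longrightarrow> ((\<lambda>Bi. T3 Bi x t) \<longlongrightarrow> T3_inf x t) at_top) \<and>
      ((\<lambda>Bi. s3 Bi t) \<longlongrightarrow> s3_inf t) at_top"
proof -
  note pos = assms(1-5)
  \<comment> \<open>\<open>q\<close> inverts the scaling in \<open>Biot\<close>: the coefficient
    \<open>b * q\<close> has Biot number \<open>b\<close>, so every \<open>b > 0\<close> occurs as a
    Biot number.\<close>
  define q where "q = k / sqrt (diffusivity k \<rho> c)"
  have q: "q > 0" using pos by (simp add: q_def diffusivity_def)
  have Biot: "Biot k \<rho> c (b * q) = b" for b
    using pos by (simp add: Biot_def q_def diffusivity_def)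
  have P3: "problem_P3 k \<rho> c l \<Theta> (b * q) (T3 b) (s3 b)"
    and quad: "quadratic_profile \<Theta> (T3 b) (s3 b)" if "b > 0" for b
    using assms(6,7)[of "b * q"] that q by (simp_all add: Biot)
  have "\<exists>A B. quadratic_stefan_solution k \<rho> c l \<Theta> A B (T3 b) (s3 b)" if "b > 0" for b
    using P3[OF that] quad[OF that] quadratic_profileE[OF pos]
    by (metis problem_P3_def)
  then obtain A B where
    "\<And>b. b > 0 \<Longrightarrow> quadratic_stefan_solution k \<rho> c l \<Theta> (A b) (B b) (T3 b) (s3 b)"
    by metis
  then have sol: "\<forall>\<^sub>F b in at_top. quadratic_stefan_solution k \<rho> c l \<Theta> (A b) (B b) (T3 b) (s3 b)"
    by (rule eventually_mono[OF eventually_gt_at_top])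
  have P3_ev: "\<forall>\<^sub>F b in at_top. problem_P3 k \<rho> c l \<Theta> (b * q) (T3 b) (s3 b)"
    by (rule eventually_mono[OF eventually_gt_at_top P3])
  have h: "filterlim (\<lambda>b. b * q) at_top at_top"
    by (rule filterlim_at_top_mult_tendsto_pos[OF tendsto_const q filterlim_ident])
  obtain A' B' where "quadratic_stefan_solution k \<rho> c l \<Theta> A' B' T3_inf s3_inf"
    using quadratic_profileE[OF pos] assms(8,9) unfolding problem_P3_inf_def by metis
  from problem_P3_tendsto[OF sol P3_ev h this assms(8)] show ?thesis
    by blast
qed

end
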